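(* Let $G$ be a finite connected undirected multigraph (multiple edges and loops allowed). Let $D$ be a spanning mixed multigraph obtained from $G$ by deleting some (possibly no) edges and orienting some (possibly no) of the non-loop edges so that no digons are created. The following statements are equivalent: (a) $G$ and $D$ are $H$-cospectral. (b) $\lambda_1(G)=\lambda_1(D)$. (c) None of the edges have been deleted, i.e., $G(D)=G$, and there exists a partition of the vertex-set of $D$ into four (possibly empty) parts $V_1,V_{-1},V_i,V_{-i}$ such that the following holds: for each $j\in\{1,-1,i,-i\}$, the mixed multigraph induced by $V_j$ in $D$ contains only undirected edges; and every other edge of $D$ is an arc $(u,v)$ (directed from $u$ to $v$) such that $u\in V_j$ and $v\in V_{-ij}$ for some $j\in\{1,-1,i,-i\}$, where $-ij$ denotes the product of the complex numbers $-i$ and $j$. (d) $G$ and $D$ are switching equivalent.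
   Context: A mixed multigraph $D$ consists of a finite vertex-set $V=V(D)$ together with undirected edges (loops and parallel edges allowed) and directed edges (arcs) $(x,y)$, $x\ne y$, from $x$ to $y$ (parallel arcs allowed). A digon is a pair of arcs joining the same two vertices in opposite directions; mixed multigraphs considered here contain no digons. An undirected multigraph is a mixed multigraph with no arcs. The underlying multigraph $G(D)$ is obtained by replacing each arc by an undirected edge. The Hermitian adjacency matrix $H(D)\in\mathbb{C}^{V\times V}$ has as $(u,v)$-entry the sum of the contributions of all edges joining $u$ and $v$: for $u\neq v$, each undirected edge joining $u$ and $v$ contributes $1$, each arc from $u$ to $v$ contributes the imaginary unit $i$ and each arc from $v$ to $u$ contributes $-i$; each loop at $v$ contributes $1$ to the entry $H(D)_{vv}$. The matrix $H(D)$ is Hermitian; its eigenvalues (with multiplicity) $\lambda_1(D)\ge\lambda_2(D)\ge\dots\ge\lambda_n(D)$, $n=|V(D)|$, form the $H$-spectrum of $D$. Two mixed multigraphs are $H$-cospectral if they have the same $H$-spectrum (as multisets). Let $\mathcal{S}$ be the set of diagonal matrices indexed by $V$ with all diagonal entries in $\{1,-1,i,-i\}$. A mixed multigraph $D'$ on the vertex set $V(D)$ is obtained from $D$ by a four-way switching if $H(D')=S^{-1}H(D)S$ for some $S\in\mathcal{S}$. The converse $D^T$ of $D$ is obtained by reversing all arcs, so that $H(D^T)=\overline{H(D)}$. Two mixed multigraphs are switching equivalent if one can be obtained from the other by a finite sequence of four-way switchings and operations of taking the converse. *)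

theory Defs
  imports "HOL-Analysis.Analysis" "HOL-Library.Uprod" "HOL-Computational_Algebra.Polynomial"
begin

text \<open>
  The vertex set \<open>V\<close> is the (nonempty, finite) type \<open>'v\<close>. Edges form multisets, so parallel
  edges and arcs are counted with multiplicity; a loop at \<open>v\<close> is \<open>Upair v v\<close>, and an arc from
  \<open>x\<close> to \<open>y\<close> is the pair \<open>(x, y)\<close>.
\<close>

record 'v mixed_mgraph =
  uedges :: "'v uprod multiset"
  arcs :: "('v \<times> 'v) multiset"

definition mixed_multigraph :: "'v mixed_mgraph \<Rightarrow> bool" where
  "mixed_multigraph D \<longleftrightarrow>
     (\<forall>(x, y) \<in># arcs D. x \<noteq> y) \<and>
     \<not> (\<exists>x y. (x, y) \<in># arcs D \<and> (y, x) \<in># arcs D)"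

definition undirected_multigraph :: "'v mixed_mgraph \<Rightarrow> bool" where
  "undirected_multigraph G \<longleftrightarrow> mixed_multigraph G \<and> arcs G = {#}"

definition underlying :: "'v mixed_mgraph \<Rightarrow> 'v mixed_mgraph" where
  "underlying D =
     \<lparr>uedges = uedges D + image_mset (\<lambda>(x, y). Upair x y) (arcs D), arcs = {#}\<rparr>"

definition connected_multigraph :: "'v mixed_mgraph \<Rightarrow> bool" where
  "connected_multigraph D \<longleftrightarrow>
     (\<forall>u v. (\<lambda>x y. Upair x y \<in># uedges (underlying D))\<^sup>*\<^sup>* u v)"

definition induced :: "'v mixed_mgraph \<Rightarrow> 'v set \<Rightarrow> 'v mixed_mgraph" where
  "induced D W =
     \<lparr>uedges = {#e \<in># uedges D. set_uprod e \<subseteq> W#},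
      arcs = {#(x, y) \<in># arcs D. x \<in> W \<and> y \<in> W#}\<rparr>"

text \<open>
  \<open>Del\<close> is the multiset of deleted edges of \<open>G\<close> and \<open>Ori\<close> the multiset of edges that are
  oriented, each of them becoming one arc of \<open>D\<close>. That \<open>Ori\<close> contains no loops and that no
  digons arise is part of \<open>mixed_multigraph D\<close>.
\<close>

definition delete_orient :: "'v mixed_mgraph \<Rightarrow> 'v mixed_mgraph \<Rightarrow> bool" where
  "delete_orient G D \<longleftrightarrow>
     mixed_multigraph D \<and>
     (\<exists>Del Ori. Del + Ori \<subseteq># uedges G \<and>
        uedges D = uedges G - (Del + Ori) \<and>
        image_mset (\<lambda>(x, y). Upair x y) (arcs D) = Ori)"

text \<open>
  For \<open>u = v\<close> the two arc terms cancel, leaving the number of loops at \<open>v\<close>.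
\<close>

definition hermitian_adj :: "'v::finite mixed_mgraph \<Rightarrow> complex^'v^'v" where
  "hermitian_adj D =
     (\<chi> u v. of_nat (count (uedges D) (Upair u v))
           + of_nat (count (arcs D) (u, v)) * \<i>
           - of_nat (count (arcs D) (v, u)) * \<i>)"

definition charpoly :: "'a::comm_ring_1^'n^'n \<Rightarrow> 'a poly" where
  "charpoly A = det (\<chi> i j. (if i = j then [:0, 1:] else 0) - [:A $ i $ j:])"

definition H_spectrum :: "'v::finite mixed_mgraph \<Rightarrow> complex multiset" where
  "H_spectrum D = proots (charpoly (hermitian_adj D))"

definition H_cospectral :: "'v::finite mixed_mgraph \<Rightarrow> 'v mixed_mgraph \<Rightarrow> bool" where
  "H_cospectral D D' \<longleftrightarrow> H_spectrum D = H_spectrum D'"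

text \<open>
  \<open>eigval k D\<close> is the \<open>k\<close>-th largest eigenvalue for \<open>1 \<le> k \<le> CARD('v)\<close>. Since \<open>hermitian_adj D\<close>
  is Hermitian, its eigenvalues are real and \<open>Re\<close> only moves them to the ordered type \<open>real\<close>.
\<close>

definition eigval :: "nat \<Rightarrow> 'v::finite mixed_mgraph \<Rightarrow> real" where
  "eigval k D = rev (sorted_list_of_multiset (image_mset Re (H_spectrum D))) ! (k - 1)"

definition fourth_roots :: "complex set" where
  "fourth_roots = {1, -1, \<i>, -\<i>}"

definition switching_matrices :: "(complex^'v^'v) set" where
  "switching_matrices =
     {S. (\<forall>v. S $ v $ v \<in> fourth_roots) \<and> (\<forall>u v. u \<noteq> v \<longrightarrow> S $ u $ v = 0)}"

definition four_way_switching :: "'v::finite mixed_mgraph \<Rightarrow> 'v mixed_mgraph \<Rightarrow> bool" where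
  "four_way_switching D D' \<longleftrightarrow>
     mixed_multigraph D \<and> mixed_multigraph D' \<and>
     (\<exists>S \<in> switching_matrices.
        hermitian_adj D' = matrix_inv S ** hermitian_adj D ** S)"

definition converse_graph :: "'v mixed_mgraph \<Rightarrow> 'v mixed_mgraph" where
  "converse_graph D = \<lparr>uedges = uedges D, arcs = image_mset prod.swap (arcs D)\<rparr>"

definition switching_step :: "'v::finite mixed_mgraph \<Rightarrow> 'v mixed_mgraph \<Rightarrow> bool" where
  "switching_step D D' \<longleftrightarrow> four_way_switching D D' \<or> D' = converse_graph D"

definition switching_equivalent :: "'v::finite mixed_mgraph \<Rightarrow> 'v mixed_mgraph \<Rightarrow> bool" where
  "switching_equivalent D D' \<longleftrightarrow> switching_step\<^sup>*\<^sup>* D D' \<or> switching_step\<^sup>*\<^sup>* D' D"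

text \<open>
  The four parts are \<open>P j\<close> for \<open>j \<in> fourth_roots\<close>; values of \<open>P\<close> elsewhere are irrelevant.
\<close>

definition switching_partition :: "'v mixed_mgraph \<Rightarrow> (complex \<Rightarrow> 'v set) \<Rightarrow> bool" where
  "switching_partition D P \<longleftrightarrow>
     (\<Union>j \<in> fourth_roots. P j) = UNIV \<and> disjoint_family_on P fourth_roots \<and>
     (\<forall>j \<in> fourth_roots. arcs (induced D (P j)) = {#}) \<and>
     (\<forall>e \<in># uedges D. \<exists>j \<in> fourth_roots. e \<in># uedges (induced D (P j))) \<and>
     (\<forall>(u, v) \<in># arcs D. \<exists>j \<in> fourth_roots. u \<in> P j \<and> v \<in> P (- \<i> * j))"

end

theory Submission
  imports Defs
begin

text \<open>
  If \<open>x\<close> is an eigenvector of \<open>H(D)\<close> for \<open>\<lambda>\<^sub>1(D)\<close>, then comparing the quadratic forms of \<open>H(D)\<close> at \<open>x\<close>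
  and of \<open>H(G)\<close> at \<open>|x|\<close> term by term gives \<open>\<lambda>\<^sub>1(D) \<le> \<lambda>\<^sub>1(G)\<close>. In the case of equality \<open>|x|\<close> is an
  eigenvector of the connected multigraph \<open>G\<close>, so it has no zero entry, and every edge of \<open>G\<close> is
  tight: it survives in \<open>D\<close> and determines the quotient of the phases of \<open>x\<close> at its ends, which is
  \<open>1\<close> for an undirected edge and \<open>-\<i>\<close> for an arc. The phases, normalised at one vertex, are the
  partition in (c). Conversely a partition is a diagonal matrix that switches \<open>G\<close> to \<open>D\<close>, and
  switchings (similarities) and converses (transposes) preserve the characteristic polynomial.
\<close>

section \<open>Maximal Rayleigh quotients of self-adjoint operators\<close>

text \<open>By compactness the quadratic form attains its maximum \<open>\<mu>\<close> on the unit
  sphere, and scaling extends the bound to all vectors. The last conclusion drives the equality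
  case: a vector that merely attains the bound is already an eigenvector.\<close>

lemma self_adjoint_max_eigenvector:
  fixes f :: "'a::euclidean_space \<Rightarrow> 'a"
  assumes lin: "linear f" and sa: "\<And>x y. f x \<bullet> y = x \<bullet> f y"
  obtains \<mu> x where "x \<noteq> 0" "f x = \<mu> *\<^sub>R x" "\<And>y. f y \<bullet> y \<le> \<mu> * (y \<bullet> y)"
    "\<And>y. f y \<bullet> y = \<mu> * (y \<bullet> y) \<Longrightarrow> f y = \<mu> *\<^sub>R y"
proof -
  have cont: "continuous_on S (\<lambda>x. f x \<bullet> x)" for S
    using lin by (intro continuous_intros linear_continuous_on_compose[OF continuous_on_id])
  obtain e :: 'a where e: "e \<in> Basis" using nonempty_Basis by blast
  have "sphere (0::'a) 1 \<noteq> {}" using e by (auto intro!: exI[of _ e])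
  then obtain x where x: "norm x = 1" "\<And>y. norm y = 1 \<Longrightarrow> f y \<bullet> y \<le> f x \<bullet> x"
    using continuous_attains_sup[OF compact_sphere _ cont, of "0::'a" 1] by auto
  define \<mu> where "\<mu> = f x \<bullet> x"
  have le: "f y \<bullet> y \<le> \<mu> * (y \<bullet> y)" for y
  proof (cases "y = 0")
    case True
    then show ?thesis by simp
  next
    case False
    have "f (y /\<^sub>R norm y) \<bullet> (y /\<^sub>R norm y) \<le> \<mu>"
      unfolding \<mu>_def using False by (intro x(2)) simp
    moreover have "f (y /\<^sub>R norm y) \<bullet> (y /\<^sub>R norm y) = (f y \<bullet> y) / (y \<bullet> y)"
      using lin by (simp add: linear_cmul dot_square_norm power2_eq_square divide_simps)
    ultimately have "(f y \<bullet> y) / (y \<bullet> y) \<le> \<mu>" by simp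
    then show ?thesis using False by (simp add: pos_divide_le_eq)
  qed
  \<comment> \<open>A maximiser \<open>y\<close> is a zero of the nonnegative quadratic form \<open>\<mu> |z|\<^sup>2 - \<langle>f z, z\<rangle>\<close>, hence
     lies in its radical.\<close>
  have eq: "f y = \<mu> *\<^sub>R y" if y: "f y \<bullet> y = \<mu> * (y \<bullet> y)" for y
  proof -
    define z where "z = f y - \<mu> *\<^sub>R y"
    define b where "b = z \<bullet> z"
    define q where "q = \<mu> * (z \<bullet> z) - f z \<bullet> z"
    have q: "q \<ge> 0" using le[of z] by (simp add: q_def)
    \<comment> \<open>This is the bound \<open>le\<close> at the perturbed vector
      \<open>y + t *\<^sub>R z\<close>. Since \<open>z\<close> is the residual of the eigenvalue
      equation, the linear coefficient in \<open>t\<close> is governed by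
      \<open>z \<bullet> z\<close>.\<close>
    have key: "0 \<le> t\<^sup>2 * q - 2 * t * b" for t
    proof -
      have "f z \<bullet> y = f y \<bullet> z" by (metis sa inner_commute)
      then have "f (y + t *\<^sub>R z) \<bullet> (y + t *\<^sub>R z) = \<mu> * (y \<bullet> y) + 2 * t * (f y \<bullet> z) + t\<^sup>2 * (f z \<bullet> z)"
        using lin y by (simp add: linear_add linear_cmul inner_add_left inner_add_right power2_eq_square algebra_simps)
      moreover have "(y + t *\<^sub>R z) \<bullet> (y + t *\<^sub>R z) = y \<bullet> y + 2 * t * (y \<bullet> z) + t\<^sup>2 * (z \<bullet> z)"
        by (simp add: inner_add_left inner_add_right inner_commute[of z y] power2_eq_square algebra_simps)
      moreover have "f y \<bullet> z = b + \<mu> * (y \<bullet> z)"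
        unfolding b_def by (subst (2) z_def) (simp add: inner_diff_left)
      ultimately show ?thesis
        using le[of "y + t *\<^sub>R z"] by (simp add: q_def algebra_simps)
    qed
    have "b = 0"
    proof (rule ccontr)
      assume "b \<noteq> 0"
      then have b: "b > 0" by (simp add: b_def)
      \<comment> \<open>The quadratic in \<open>t\<close> is smallest at \<open>b / q\<close>; the
        denominator \<open>q + 1\<close> also covers \<open>q = 0\<close> and still gives a negative
        value.\<close>
      have "(b / (q + 1))\<^sup>2 * q - 2 * (b / (q + 1)) * b = - (b\<^sup>2 * (q + 2)) / (q + 1)\<^sup>2"
        using q by (simp add: divide_simps power2_eq_square) (simp add: algebra_simps)
      moreover have "\<dots> < 0" using b q by (intro divide_neg_pos) auto
      ultimately show False using key[of "b / (q + 1)"] by linarith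
    qed
    then show ?thesis by (simp add: b_def z_def)
  qed
  have fx: "f x = \<mu> *\<^sub>R x" using x(1) by (intro eq) (simp add: \<mu>_def dot_square_norm)
  have "x \<noteq> 0" using x(1) by auto
  then show ?thesis using fx le eq by (rule that)
qed

section \<open>Inverses and diagonal matrices\<close>

text \<open>\<open>matrix_inv\<close> chooses some two-sided inverse. For square matrices over a
  field a left inverse is two-sided, and inverses are unique, so the choice is forced.\<close>

lemma matrix_inv_eqI:
  fixes A B :: "'a::field^'n^'n"
  assumes "B ** A = mat 1"
  shows "matrix_inv A = B"
proof -
  have "A ** B = mat 1" by (rule iffD1[OF matrix_left_right_inverse assms])
  then have "\<exists>B. A ** B = mat 1 \<and> B ** A = mat 1" using assms by blast
  then have "A ** matrix_inv A = mat 1" unfolding matrix_inv_def by (rule someI2_ex) blast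
  then show ?thesis by (metis assms matrix_mul_assoc matrix_mul_lid matrix_mul_rid)
qed

definition diag_mat :: "('n \<Rightarrow> 'a::zero) \<Rightarrow> 'a^'n^'n" where
  "diag_mat d = (\<chi> u v. if u = v then d u else 0)"

lemma diag_mat_mult:
  fixes A :: "'a::semiring_1^'n^'n"
  shows "(diag_mat d ** A) $ u $ v = d u * A $ u $ v"
    and "(A ** diag_mat d) $ u $ v = A $ u $ v * d v"
  by (simp_all add: diag_mat_def matrix_matrix_mult_def if_distrib[of "\<lambda>x. x * _"] if_distrib[of "\<lambda>x. _ * x"]
      cong: if_cong)

lemma diag_mat_inverse:
  fixes d e :: "'n::finite \<Rightarrow> 'a::semiring_1"
  assumes "\<And>u. d u * e u = 1"
  shows "diag_mat d ** diag_mat e = mat 1"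
  using assms unfolding vec_eq_iff diag_mat_mult by (simp add: diag_mat_def mat_def)

section \<open>Characteristic polynomials\<close>

lemma poly_det:
  fixes A :: "'a::comm_ring_1 poly^'n^'n"
  shows "poly (det A) z = det (\<chi> i j. poly (A $ i $ j) z)"
  by (simp add: det_def poly_sum poly_prod)

lemma poly_charpoly: "poly (charpoly A) z = det (mat z - A)"
  unfolding charpoly_def poly_det by (intro arg_cong[of _ _ det]) (simp add: vec_eq_iff mat_def)

text \<open>A polynomial over an infinite field is determined by its values, so identities of
  characteristic polynomials reduce to identities of complex determinants.\<close>

lemma charpoly_eqI:
  fixes A B :: "complex^'n^'n"
  assumes "\<And>z. det (mat z - A) = det (mat z - B)"
  shows "charpoly A = charpoly B"
  using assms by (simp add: poly_eq_poly_eq_iff[symmetric] fun_eq_iff poly_charpoly)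

lemma charpoly_transpose:
  fixes A :: "complex^'n^'n"
  shows "charpoly (transpose A) = charpoly A"
proof (rule charpoly_eqI)
  fix z
  have "mat z - transpose A = transpose (mat z - A)"
    by (auto simp: vec_eq_iff mat_def transpose_def)
  then show "det (mat z - transpose A) = det (mat z - A)" by (simp add: det_transpose)
qed

lemma charpoly_similar:
  fixes A P Q :: "complex^'n^'n"
  assumes PQ: "P ** Q = mat 1"
  shows "charpoly (P ** A ** Q) = charpoly A"
proof (rule charpoly_eqI)
  fix z
  \<comment> \<open>Scalar matrices are central, so conjugation fixes \<open>mat z\<close> and acts
    only on \<open>A\<close>.\<close>
  have "P ** mat z = mat z ** P"
    by (simp add: vec_eq_iff matrix_matrix_mult_def mat_def if_distrib if_distribR mult.commute cong: if_cong)
  then have "P ** mat z ** Q = mat z"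
    by (simp add: PQ flip: matrix_mul_assoc)
  moreover have "P ** (mat z - A) ** Q = P ** mat z ** Q - P ** A ** Q"
    by (simp add: vec_eq_iff matrix_matrix_mult_def sum_subtractf algebra_simps)
  ultimately have "det (mat z - P ** A ** Q) = det (P ** (mat z - A) ** Q)" by simp
  also have "\<dots> = (det P * det Q) * det (mat z - A)" by (simp add: det_mul)
  also have "det P * det Q = 1" by (metis PQ det_mul det_I)
  finally show "det (mat z - P ** A ** Q) = det (mat z - A)" by simp
qed

lemma det_mat_minus_eq_0_iff:
  fixes A :: "complex^'n^'n"
  shows "det (mat z - A) = 0 \<longleftrightarrow> (\<exists>x. x \<noteq> 0 \<and> A *v x = z *s x)"
proof -
  have "mat z *v x = z *s x" for x :: "complex^'n"
    by (simp add: vec_eq_iff matrix_vector_mult_def mat_def if_distrib if_distribR cong: if_cong)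
  then have "(mat z - A) *v x = z *s x - A *v x" for x
    by (simp add: matrix_vector_mult_diff_rdistrib)
  then have "(mat z - A) *v x = 0 \<longleftrightarrow> A *v x = z *s x" for x
    by (auto simp: eq_commute[of "z *s x"])
  moreover have "det (mat z - A) \<noteq> 0 \<longleftrightarrow> (\<forall>x. (mat z - A) *v x = 0 \<longrightarrow> x = 0)"
    unfolding invertible_det_nz[symmetric] invertible_left_inverse by (rule matrix_left_invertible_ker)
  ultimately show ?thesis by blast
qed

section \<open>Hermitian matrices and the largest eigenvalue\<close>

text \<open>Here \<open>\<bullet>\<close> is the real part of the Hermitian inner product on
  \<open>complex^'n\<close>, for which the adjoint of multiplication by a scalar is multiplication
  by its conjugate. This makes the real theory of self-adjoint maps applicable.\<close>

lemma hermitian_inner: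
  fixes A :: "complex^'n^'n"
  assumes "\<And>u v. A $ v $ u = cnj (A $ u $ v)"
  shows "(A *v x) \<bullet> y = x \<bullet> (A *v y)"
proof -
  have "(A *v x) \<bullet> y = (\<Sum>u\<in>UNIV. \<Sum>v\<in>UNIV. (A $ u $ v * x $ v) \<bullet> y $ u)"
    by (simp add: inner_vec_def matrix_vector_mult_def inner_sum_left)
  also have "\<dots> = (\<Sum>v\<in>UNIV. \<Sum>u\<in>UNIV. (A $ u $ v * x $ v) \<bullet> y $ u)"
    by (rule sum.swap)
  also have "\<dots> = (\<Sum>v\<in>UNIV. \<Sum>u\<in>UNIV. x $ v \<bullet> (A $ v $ u * y $ u))"
    by (intro sum.cong refl, subst assms) (simp add: inner_complex_def algebra_simps)
  also have "\<dots> = x \<bullet> (A *v y)"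
    by (simp add: inner_vec_def matrix_vector_mult_def inner_sum_right)
  finally show ?thesis .
qed

text \<open>Links the first eigenvalue, read off a sorted list of polynomial roots, to its
  variational description: it is the maximum \<open>\<nu>\<close> of the Rayleigh quotient.\<close>

lemma eigval_1_rayleigh:
  fixes D :: "'v::finite mixed_mgraph"
  defines "A \<equiv> hermitian_adj D" and "\<mu> \<equiv> eigval 1 D"
  shows "\<exists>x. x \<noteq> 0 \<and> A *v x = \<mu> *\<^sub>R x"
    and "(A *v y) \<bullet> y \<le> \<mu> * (y \<bullet> y)"
    and "(A *v y) \<bullet> y = \<mu> * (y \<bullet> y) \<Longrightarrow> A *v y = \<mu> *\<^sub>R y"
proof -
  have "Upair v u = Upair u v" for u v :: 'v by simp
  then have herm: "A $ v $ u = cnj (A $ u $ v)" for u v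
    by (simp only: A_def hermitian_adj_def vec_lambda_beta) simp
  have lin: "linear ((*v) A)"
    by (intro linearI matrix_vector_right_distrib)
      (simp add: vec_eq_iff matrix_vector_mult_def scaleR_sum_right)
  obtain \<nu> x where x: "x \<noteq> 0" "A *v x = \<nu> *\<^sub>R x" "\<And>y. (A *v y) \<bullet> y \<le> \<nu> * (y \<bullet> y)"
    "\<And>y. (A *v y) \<bullet> y = \<nu> * (y \<bullet> y) \<Longrightarrow> A *v y = \<nu> *\<^sub>R y"
    by (rule self_adjoint_max_eigenvector[OF lin hermitian_inner[OF herm]]) (rule that)
  \<comment> \<open>Self-adjointness tested on an eigenvector \<open>w\<close> and on
    \<open>\<i> *s w\<close> forces \<open>z\<close> to be real; the Rayleigh bound at
    \<open>w\<close> then limits it.\<close>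
  have eigen: "Im z = 0 \<and> Re z \<le> \<nu>" if "det (mat z - A) = 0" for z
  proof -
    from that have "\<exists>w. w \<noteq> 0 \<and> A *v w = z *s w" by (rule iffD1[OF det_mat_minus_eq_0_iff])
    then obtain w where w: "w \<noteq> 0" "A *v w = z *s w" by (elim exE conjE)
    have smul: "(c *s w) \<bullet> w = Re c * (w \<bullet> w)" for c
      by (simp add: inner_vec_def inner_complex_def sum_distrib_left algebra_simps)
    have "(A *v w) \<bullet> (\<i> *s w) = Im z * (w \<bullet> w)"
      unfolding w(2) by (simp add: inner_vec_def inner_complex_def sum_distrib_left algebra_simps)
    moreover have "A *v (\<i> *s w) = (\<i> * z) *s w"
      by (simp add: vector_scalar_commute w(2))
    then have "w \<bullet> (A *v (\<i> *s w)) = - Im z * (w \<bullet> w)"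
      using smul[of "\<i> * z"] by (simp add: inner_commute)
    ultimately have "Im z * (w \<bullet> w) = - Im z * (w \<bullet> w)"
      using hermitian_inner[OF herm, of w "\<i> *s w"] by simp
    moreover have "w \<bullet> w > 0" using w by simp
    ultimately have "Im z = 0" by simp
    moreover have "Re z \<le> \<nu>"
      using x(3)[of w] \<open>w \<bullet> w > 0\<close> by (simp add: w(2) smul)
    ultimately show ?thesis by simp
  qed
  \<comment> \<open>All eigenvalues are real, so \<open>\<i>\<close> witnesses that the polynomial
    is nonzero; only then does \<open>proots\<close> consist of exactly its zeros.\<close>
  have "poly (charpoly A) \<i> \<noteq> 0" using eigen[of \<i>] by (auto simp: poly_charpoly)
  then have "charpoly A \<noteq> 0" by auto
  then have roots: "set_mset (H_spectrum D) = {z. det (mat z - A) = 0}"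
    by (simp add: H_spectrum_def poly_charpoly flip: A_def)
  have "A *v x = complex_of_real \<nu> *s x"
    unfolding x(2) by (simp add: vec_eq_iff scaleR_conv_of_real[of _ "_ :: complex"])
  then have "det (mat (complex_of_real \<nu>) - A) = 0"
    using x(1) by (intro iffD2[OF det_mat_minus_eq_0_iff] exI[of _ x] conjI)
  then have root: "complex_of_real \<nu> \<in># H_spectrum D"
    by (simp add: roots)
  define xs where "xs = sorted_list_of_multiset (image_mset Re (H_spectrum D))"
  have set: "set xs = Re ` set_mset (H_spectrum D)" by (simp add: xs_def)
  have sorted: "sorted xs" by (simp add: xs_def)
  have \<nu>: "\<nu> \<in> set xs" using root unfolding set by force
  then have ne: "xs \<noteq> []" by auto
  \<comment> \<open>\<open>eigval 1\<close> takes index 0 of the reversed ascending list.\<close>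
  have "\<mu> = last xs"
    using ne by (simp add: \<mu>_def eigval_def flip: xs_def) (metis hd_conv_nth hd_rev rev_is_Nil_conv)
  moreover have "last xs \<le> \<nu>"
    using last_in_set[OF ne] eigen by (auto simp: set roots)
  moreover have "\<nu> \<le> last xs"
  proof -
    obtain i where "i < length xs" "\<nu> = xs ! i" using \<nu> by (auto simp: in_set_conv_nth)
    then show ?thesis using sorted ne by (simp add: last_conv_nth sorted_nth_mono)
  qed
  ultimately have "\<mu> = \<nu>" by simp
  then show "\<exists>x. x \<noteq> 0 \<and> A *v x = \<mu> *\<^sub>R x" "(A *v y) \<bullet> y \<le> \<mu> * (y \<bullet> y)"
    "(A *v y) \<bullet> y = \<mu> * (y \<bullet> y) \<Longrightarrow> A *v y = \<mu> *\<^sub>R y"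
    using x by auto
qed

section \<open>Edge multiplicities and phase functions\<close>

text \<open>A pair \<open>(x, x)\<close> would be counted once on the left and twice on the right,
  whence the exclusion of equal ends.\<close>

lemma count_forget_direction:
  assumes "\<forall>(x, y) \<in># M. x \<noteq> y"
  shows "count (image_mset (\<lambda>(x, y). Upair x y) M) (Upair u v) = count M (u, v) + count M (v, u)"
  using assms
proof (induction M)
  case (add p M)
  obtain x y where p: "p = (x, y)" by fastforce
  have "x \<noteq> y" using add.prems p by simp
  have Upair_eq: "Upair x y = Upair u v \<longleftrightarrow> (x, y) = (u, v) \<or> (x, y) = (v, u)" by simp
  have one: "(if Upair x y = Upair u v then 1 else 0)
      = (if (x, y) = (u, v) then 1 else 0) + (if (x, y) = (v, u) then 1 else (0::nat))"
    unfolding Upair_eq using \<open>x \<noteq> y\<close> by (cases "x = u"; cases "y = v") simp_all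
  have IH: "count (image_mset (\<lambda>(x, y). Upair x y) M) (Upair u v) = count M (u, v) + count M (v, u)"
    using add.prems by (intro add.IH) simp
  have count_Suc: "count (add_mset a N) b = (if a = b then 1 else 0) + count N b" for a b :: 'b and N
    by simp
  show ?case
    unfolding p image_mset_add_mset prod.case count_Suc IH one by simp
qed simp

abbreviation edge_mult :: "'v mixed_mgraph \<Rightarrow> 'v \<Rightarrow> 'v \<Rightarrow> real" where
  "edge_mult D u v \<equiv> real (count (uedges D) (Upair u v))"

abbreviation arc_mult :: "'v mixed_mgraph \<Rightarrow> 'v \<Rightarrow> 'v \<Rightarrow> real" where
  "arc_mult D u v \<equiv> real (count (arcs D) (u, v))"

text \<open>
  A partition as in (c) is the same as a phase function \<open>s\<close>, constant along undirected edges and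
  multiplied by \<open>-\<i>\<close> along arcs.
\<close>

definition phase_function :: "'v mixed_mgraph \<Rightarrow> ('v \<Rightarrow> complex) \<Rightarrow> bool" where
  "phase_function D s \<longleftrightarrow> (\<forall>v. s v \<in> fourth_roots) \<and>
     (\<forall>u v. (edge_mult D u v \<noteq> 0 \<longrightarrow> s v = s u) \<and> (arc_mult D u v \<noteq> 0 \<longrightarrow> s v = - \<i> * s u))"

text \<open>The parts are the fibres of \<open>s\<close>; conversely, \<open>s v\<close> is the
  index of the unique part containing \<open>v\<close>.\<close>

lemma switching_partition_iff: "(\<exists>P. switching_partition D P) \<longleftrightarrow> (\<exists>s. phase_function D s)"
proof
  assume "\<exists>P. switching_partition D P"
  then obtain P where cover: "(\<Union>j \<in> fourth_roots. P j) = UNIV"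
    and disj: "disjoint_family_on P fourth_roots"
    and edges: "\<forall>e \<in># uedges D. \<exists>j \<in> fourth_roots. e \<in># uedges (induced D (P j))"
    and arcs: "\<forall>(u, v) \<in># arcs D. \<exists>j \<in> fourth_roots. u \<in> P j \<and> v \<in> P (- \<i> * j)"
    by (auto simp: switching_partition_def)
  have "\<exists>j \<in> fourth_roots. v \<in> P j" for v using cover by blast
  then obtain s where s: "\<And>v. s v \<in> fourth_roots" "\<And>v. v \<in> P (s v)" by metis
  have uniq: "s v = j" if "v \<in> P j" "j \<in> fourth_roots" for v j
    using disj s[of v] that by (auto simp: disjoint_family_on_def)
  have rot: "- \<i> * j \<in> fourth_roots" if "j \<in> fourth_roots" for j
    using that by (auto simp: fourth_roots_def)
  have "phase_function D s"
    unfolding phase_function_def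
  proof (intro conjI allI impI)
    fix u v
    show "s v \<in> fourth_roots" by (rule s)
    show "s v = s u" if "edge_mult D u v \<noteq> 0"
    proof -
      have "Upair u v \<in># uedges D" using that by simp
      then obtain j where "j \<in> fourth_roots" "Upair u v \<in># uedges (induced D (P j))"
        using edges by blast
      moreover from this have "u \<in> P j" "v \<in> P j" by (auto simp: induced_def)
      ultimately have "s u = j" "s v = j" using uniq by blast+
      then show ?thesis by simp
    qed
    show "s v = - \<i> * s u" if "arc_mult D u v \<noteq> 0"
    proof -
      have "(u, v) \<in># arcs D" using that by simp
      then obtain j where "j \<in> fourth_roots" "u \<in> P j" "v \<in> P (- \<i> * j)"
        using arcs by blast
      then have "s u = j" "s v = - \<i> * j" using uniq rot by blast+
      then show ?thesis by simp
    qed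
  qed
  then show "\<exists>s. phase_function D s" by blast
next
  assume "\<exists>s. phase_function D s"
  then obtain s where phase: "phase_function D s" by blast
  have s: "s v \<in> fourth_roots" for v
    using phase unfolding phase_function_def by blast
  have edges: "s v = s u" if "Upair u v \<in># uedges D" for u v
  proof -
    have "edge_mult D u v \<noteq> 0" using that by simp
    then show ?thesis using phase unfolding phase_function_def by blast
  qed
  have arcs: "s v = - \<i> * s u" if "(u, v) \<in># arcs D" for u v
  proof -
    have "arc_mult D u v \<noteq> 0" using that by simp
    then show ?thesis using phase unfolding phase_function_def by blast
  qed
  define P where "P j = {v. s v = j}" for j
  \<comment> \<open>An arc multiplies the phase by \<open>- \<i>\<close>, which fixes no fourth root
    of unity, so no arc lies inside a part.\<close>
  have rot: "- \<i> * s u \<noteq> s u" for u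
    using s[of u] by (auto simp: fourth_roots_def complex_eq_iff)
  have "switching_partition D P"
    unfolding switching_partition_def
  proof (intro conjI ballI)
    show "(\<Union>j \<in> fourth_roots. P j) = UNIV" using s by (auto simp: P_def)
    show "disjoint_family_on P fourth_roots" by (auto simp: disjoint_family_on_def P_def)
    show "arcs (induced D (P j)) = {#}" for j
    proof -
      have "\<not> (u \<in> P j \<and> v \<in> P j)" if "(u, v) \<in># arcs D" for u v
        using arcs[OF that] rot[of u] by (auto simp: P_def)
      then have "{#(u, v) \<in># arcs D. u \<in> P j \<and> v \<in> P j#} = {#}"
        unfolding filter_mset_eq_conv by fastforce
      then show ?thesis by (simp add: induced_def)
    qed
    show "\<exists>j \<in> fourth_roots. e \<in># uedges (induced D (P j))" if "e \<in># uedges D" for e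
    proof -
      obtain u v where e: "e = Upair u v" by (metis uprod_exhaust)
      then have "s v = s u" using that edges by blast
      then have "e \<in># uedges (induced D (P (s u)))"
        using that by (simp add: e induced_def P_def)
      then show ?thesis using s by blast
    qed
    show "case e of (u, v) \<Rightarrow> \<exists>j \<in> fourth_roots. u \<in> P j \<and> v \<in> P (- \<i> * j)" if "e \<in># arcs D" for e
    proof -
      obtain u v where e: "e = (u, v)" by force
      then have "v \<in> P (- \<i> * s u)" "u \<in> P (s u)" using that arcs[of u v] by (auto simp: P_def)
      then show ?thesis using s e by blast
    qed
  qed
  then show "\<exists>P. switching_partition D P" by blast
qed

section \<open>Comparing the multiplicities of \<open>G\<close> and \<open>D\<close>\<close>

context
  fixes G D :: "'v::finite mixed_mgraph"
  assumes G: "undirected_multigraph G"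
    and conn: "connected_multigraph G"
    and del: "delete_orient G D"
begin

lemma arcs_G: "arcs G = {#}" and mixed_D: "mixed_multigraph D"
  using G del by (auto simp: undirected_multigraph_def delete_orient_def)

lemma adj_G: "hermitian_adj G $ u $ v = of_real (edge_mult G u v)"
  by (simp add: hermitian_adj_def arcs_G)

lemma adj_D: "hermitian_adj D $ u $ v = of_real (edge_mult D u v) + of_real (arc_mult D u v) * \<i> - of_real (arc_mult D v u) * \<i>"
  by (simp add: hermitian_adj_def)

lemma count_underlying_D: "real (count (uedges (underlying D)) (Upair u v)) = edge_mult D u v + arc_mult D u v + arc_mult D v u"
  using mixed_D by (simp add: underlying_def mixed_multigraph_def count_forget_direction)

lemma underlying_D_le: "uedges (underlying D) \<subseteq># uedges G"
proof -
  obtain Del Ori where "Del + Ori \<subseteq># uedges G" "uedges D = uedges G - (Del + Ori)"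
    "image_mset (\<lambda>(x, y). Upair x y) (arcs D) = Ori"
    using del by (auto simp: delete_orient_def)
  then show ?thesis
    by (auto simp: underlying_def subseteq_mset_def le_diff_conv2)
qed

text \<open>The difference of the two sides is the number of deleted edges between \<open>u\<close>
  and \<open>v\<close>.\<close>

lemma mult_ge: "edge_mult D u v + arc_mult D u v + arc_mult D v u \<le> edge_mult G u v"
  using mset_subset_eq_count[OF underlying_D_le, of "Upair u v"]
  by (simp flip: count_underlying_D)

lemma underlying_D_eq_iff: "underlying D = G \<longleftrightarrow> (\<forall>u v. edge_mult D u v + arc_mult D u v + arc_mult D v u = edge_mult G u v)"
proof
  assume "underlying D = G"
  then show "\<forall>u v. edge_mult D u v + arc_mult D u v + arc_mult D v u = edge_mult G u v"
    by (simp flip: count_underlying_D)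
next
  assume "\<forall>u v. edge_mult D u v + arc_mult D u v + arc_mult D v u = edge_mult G u v"
  then have "count (uedges (underlying D)) (Upair u v) = count (uedges G) (Upair u v)" for u v
    by (simp flip: count_underlying_D)
  then have "uedges (underlying D) = uedges G"
    by (intro multiset_eqI) (metis uprod_exhaust)
  then show "underlying D = G" using arcs_G by (simp add: underlying_def)
qed

section \<open>The equality case of the eigenvalue comparison\<close>

lemma phase_function_of_eigval_eq:
  assumes eq: "eigval 1 G = eigval 1 D"
  shows "underlying D = G \<and> (\<exists>s. phase_function D s)"
proof -
  define \<mu> where "\<mu> = eigval 1 D"
  obtain x where x: "x \<noteq> 0" "hermitian_adj D *v x = \<mu> *\<^sub>R x"
    using eigval_1_rayleigh(1)[of D] by (auto simp: \<mu>_def)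
  define y :: "complex^'v" where "y = (\<chi> v. of_real (norm (x $ v)))"
  \<comment> \<open>\<open>gap u v\<close> is the slack at \<open>(u, v)\<close> when the form of
    \<open>G\<close> at \<open>y\<close>, the entrywise modulus of \<open>x\<close>, is compared
    with that of \<open>D\<close> at \<open>x\<close>.\<close>
  define gap where "gap u v = norm (x $ u) * edge_mult G u v * norm (x $ v)
      - Re (cnj (x $ u) * hermitian_adj D $ u $ v * x $ v)" for u v
  have "norm (hermitian_adj D $ u $ v) \<le> edge_mult G u v" for u v
  proof -
    have "norm (hermitian_adj D $ u $ v) \<le> edge_mult D u v + arc_mult D u v + arc_mult D v u"
      unfolding adj_D by (rule order_trans[OF norm_triangle_ineq4] order_trans[OF add_mono[OF norm_triangle_ineq order_refl]])+
        (simp add: norm_mult)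
    then show ?thesis using mult_ge[of u v] by linarith
  qed
  then have gap_nonneg: "gap u v \<ge> 0" for u v
  proof -
    have "Re (cnj (x $ u) * hermitian_adj D $ u $ v * x $ v)
        \<le> norm (x $ u) * norm (hermitian_adj D $ u $ v) * norm (x $ v)"
      using complex_Re_le_cmod[of "cnj (x $ u) * hermitian_adj D $ u $ v * x $ v"]
      by (simp add: norm_mult)
    also have "\<dots> \<le> norm (x $ u) * edge_mult G u v * norm (x $ v)"
      using \<open>norm (hermitian_adj D $ u $ v) \<le> edge_mult G u v\<close> by (intro mult_mono) auto
    finally show ?thesis by (simp add: gap_def)
  qed
  have form: "(A *v z) \<bullet> z = (\<Sum>u\<in>UNIV. \<Sum>v\<in>UNIV. Re (cnj (z $ u) * A $ u $ v * z $ v))"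
    for A :: "complex^'v^'v" and z
  proof -
    have "(A *v z) \<bullet> z = (\<Sum>u\<in>UNIV. \<Sum>v\<in>UNIV. (A $ u $ v * z $ v) \<bullet> z $ u)"
      by (simp add: inner_vec_def matrix_vector_mult_def inner_sum_left)
    then show ?thesis by (simp add: inner_complex_def algebra_simps)
  qed
  have yy: "y \<bullet> y = x \<bullet> x"
    by (simp add: y_def inner_vec_def dot_square_norm)
  have "(hermitian_adj G *v y) \<bullet> y - (hermitian_adj D *v x) \<bullet> x = (\<Sum>u\<in>UNIV. \<Sum>v\<in>UNIV. gap u v)"
    unfolding form gap_def by (simp add: adj_G y_def sum_subtractf)
  moreover have "(hermitian_adj D *v x) \<bullet> x = \<mu> * (y \<bullet> y)" by (simp add: x yy)
  moreover have "(\<Sum>u\<in>UNIV. \<Sum>v\<in>UNIV. gap u v) \<ge> 0" by (intro sum_nonneg gap_nonneg)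
  moreover have "(hermitian_adj G *v y) \<bullet> y \<le> \<mu> * (y \<bullet> y)"
    using eigval_1_rayleigh(2)[of G y] eq by (simp add: \<mu>_def)
  \<comment> \<open>The gaps are nonnegative, but their sum is at most 0 because
    \<open>\<mu>\<close> also bounds the Rayleigh quotient of \<open>G\<close>. So the bound is
    attained at \<open>y\<close> and every gap vanishes.\<close>
  ultimately have max: "(hermitian_adj G *v y) \<bullet> y = \<mu> * (y \<bullet> y)"
    and "(\<Sum>u\<in>UNIV. \<Sum>v\<in>UNIV. gap u v) = 0" by linarith+
  then have gap: "gap u v = 0" for u v
    by (simp add: sum_nonneg_eq_0_iff sum_nonneg gap_nonneg)
  have Gy: "hermitian_adj G *v y = \<mu> *\<^sub>R y"
    using eigval_1_rayleigh(3)[of G y] max eq by (simp add: \<mu>_def)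
  \<comment> \<open>Zeros of a nonnegative eigenvector of \<open>G\<close> spread along the edges of \<open>G\<close>.\<close>
  have spread: "x $ v = 0" if "x $ u = 0" "Upair u v \<in># uedges G" for u v
  proof -
    have "(\<Sum>w\<in>UNIV. edge_mult G u w * norm (x $ w)) = 0"
    proof -
      have "(hermitian_adj G *v y) $ u = 0" using Gy that by (simp add: y_def)
      then have "complex_of_real (\<Sum>w\<in>UNIV. edge_mult G u w * norm (x $ w)) = 0"
        by (simp add: matrix_vector_mult_def adj_G y_def)
      then show ?thesis by (simp only: of_real_eq_0_iff)
    qed
    then have "edge_mult G u v * norm (x $ v) = 0"
      by (subst (asm) sum_nonneg_eq_0_iff) auto
    moreover have "edge_mult G u v \<noteq> 0" using that by simp
    ultimately show ?thesis by (simp only: mult_eq_0_iff norm_eq_zero) blast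
  qed
  have path: "(\<lambda>x y. Upair x y \<in># uedges G)\<^sup>*\<^sup>* u v" for u v
    using conn by (simp add: connected_multigraph_def underlying_def arcs_G)
  have nz: "x $ u \<noteq> 0" for u
  proof
    assume u: "x $ u = 0"
    have "x $ v = 0" for v
      using path[of u v] by (induction rule: rtranclp_induct) (use u spread in auto)
    then show False using x(1) by (simp add: vec_eq_iff)
  qed
  \<comment> \<open>An arbitrary base vertex. The phases of an eigenvector are fixed only up to a
    common unit factor; dividing by the phase at \<open>r\<close> makes
    \<open>s r = 1\<close>.\<close>
  define r :: 'v where "r = undefined"
  define s where "s v = sgn (x $ v) * cnj (sgn (x $ r))" for v
  \<comment> \<open>Phases have modulus 1, so conjugation inverts them and \<open>q u v\<close> is
    the quotient of the phases at \<open>v\<close> and \<open>u\<close>; the base factor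
    cancels.\<close>
  define q where "q u v = cnj (s u) * s v" for u v
  have norm_s: "norm (s v) = 1" for v using nz by (simp add: s_def norm_mult norm_sgn)
  have s_eq: "s v = q u v * s u" for u v
    using norm_s[of u] complex_norm_square[of "s u"] by (simp add: q_def algebra_simps)
  have norm_q: "norm (q u v) = 1" for u v using norm_s by (simp add: q_def norm_mult)
  have q_real: "q u v = 1" if "Re (q u v) = 1" for u v
    using that norm_q[of u v] by (simp add: complex_eq_iff cmod_def)
  have q_imag: "q u v = - \<i>" if "Im (q u v) = -1" for u v
    using that norm_q[of u v] by (simp add: complex_eq_iff cmod_def)
  have q_imag': "q u v = \<i>" if "Im (q u v) = 1" for u v
    using that norm_q[of u v] by (simp add: complex_eq_iff cmod_def)
  \<comment> \<open>The vanishing gap in polar form, divided by the nonzero moduli of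
    \<open>x $ u\<close> and \<open>x $ v\<close>, says that the multiplicity in \<open>G\<close> is
    the real part of \<open>q u v\<close> times the entry of \<open>D\<close>.\<close>
  have key: "edge_mult G u v = edge_mult D u v * Re (q u v) + (arc_mult D u v - arc_mult D v u) * (- Im (q u v))" for u v
  proof -
    have polar: "of_real (norm (x $ u)) * sgn (x $ u) = x $ u" for u
      using nz[of u] by (simp add: sgn_div_norm scaleR_conv_of_real)
    have q_sgn: "q u v = cnj (sgn (x $ u)) * sgn (x $ v)"
    proof -
      have "sgn (x $ r) * cnj (sgn (x $ r)) = 1"
        using nz[of r] complex_norm_square[of "sgn (x $ r)"] by (simp add: norm_sgn)
      then show ?thesis by (simp add: q_def s_def mult_ac)
    qed
    have "cnj (of_real a * z) * h * (of_real b * z') = of_real (a * b) * (cnj z * z' * h)"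
      for a b z z' h by simp
    from this[of "norm (x $ u)" "sgn (x $ u)" "hermitian_adj D $ u $ v" "norm (x $ v)" "sgn (x $ v)"]
    have "cnj (x $ u) * hermitian_adj D $ u $ v * x $ v
        = of_real (norm (x $ u) * norm (x $ v)) * (q u v * hermitian_adj D $ u $ v)"
      by (simp only: polar q_sgn)
    moreover have "Re (of_real c * z) = c * Re z" for c z by simp
    ultimately have "Re (cnj (x $ u) * hermitian_adj D $ u $ v * x $ v)
        = norm (x $ u) * norm (x $ v) * Re (q u v * hermitian_adj D $ u $ v)"
      by (simp only:)
    then have "norm (x $ u) * edge_mult G u v * norm (x $ v)
        = norm (x $ u) * norm (x $ v) * Re (q u v * hermitian_adj D $ u $ v)"
      using gap[of u v] unfolding gap_def by linarith
    then have "edge_mult G u v = Re (q u v * hermitian_adj D $ u $ v)"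
      using nz[of u] nz[of v] by simp
    then show ?thesis by (simp add: adj_D algebra_simps)
  qed
  have tight: "edge_mult D u v + arc_mult D u v + arc_mult D v u = edge_mult G u v \<and> (edge_mult D u v \<noteq> 0 \<longrightarrow> q u v = 1) \<and>
      (arc_mult D u v \<noteq> 0 \<longrightarrow> q u v = - \<i>) \<and> (arc_mult D v u \<noteq> 0 \<longrightarrow> q u v = \<i>)" for u v
  proof -
    have b: "\<bar>Re (q u v)\<bar> \<le> 1" "\<bar>Im (q u v)\<bar> \<le> 1"
      using abs_Re_le_cmod[of "q u v"] abs_Im_le_cmod[of "q u v"] norm_q by auto
    \<comment> \<open>The losses from undirected edges and from arcs in the two directions. By
      \<open>key\<close> their sum is the multiplicity in \<open>D\<close> minus that in
      \<open>G\<close>, which is at most 0, so each loss vanishes and no edge is missing.\<close>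
    define \<alpha> where "\<alpha> = edge_mult D u v * (1 - Re (q u v))"
    define \<beta> where "\<beta> = arc_mult D u v * (1 + Im (q u v))"
    define \<gamma> where "\<gamma> = arc_mult D v u * (1 - Im (q u v))"
    have "\<alpha> \<ge> 0" "\<beta> \<ge> 0" "\<gamma> \<ge> 0" using b by (auto simp: \<alpha>_def \<beta>_def \<gamma>_def)
    moreover have "edge_mult G u v + \<alpha> + \<beta> + \<gamma> = edge_mult D u v + arc_mult D u v + arc_mult D v u"
      by (simp add: key \<alpha>_def \<beta>_def \<gamma>_def algebra_simps)
    ultimately have "\<alpha> = 0" "\<beta> = 0" "\<gamma> = 0" "edge_mult D u v + arc_mult D u v + arc_mult D v u = edge_mult G u v"
      using mult_ge[of u v] by linarith+
    moreover have "Re (q u v) = 1" if "edge_mult D u v \<noteq> 0"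
      using \<open>\<alpha> = 0\<close> that unfolding \<alpha>_def mult_eq_0_iff by linarith
    moreover have "Im (q u v) = -1" if "arc_mult D u v \<noteq> 0"
      using \<open>\<beta> = 0\<close> that unfolding \<beta>_def mult_eq_0_iff by linarith
    moreover have "Im (q u v) = 1" if "arc_mult D v u \<noteq> 0"
      using \<open>\<gamma> = 0\<close> that unfolding \<gamma>_def mult_eq_0_iff by linarith
    ultimately show ?thesis using q_real q_imag q_imag' by blast
  qed
  \<comment> \<open>Along a path of \<open>G\<close> from \<open>r\<close>, each edge survives in
    \<open>D\<close> and so multiplies the phase by 1, \<open>\<i>\<close> or
    \<open>- \<i>\<close>.\<close>
  have "s v \<in> fourth_roots" for v
    using path[of r v]
  proof (induction rule: rtranclp_induct)
    case base
    have "s r = 1"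
      using nz[of r] complex_norm_square[of "sgn (x $ r)"] by (simp add: s_def norm_sgn)
    then show ?case by (simp add: fourth_roots_def)
  next
    case (step u v)
    then have "edge_mult G u v \<noteq> 0" by simp
    then have "q u v \<in> {1, - \<i>, \<i>}" using tight[of u v] by fastforce
    then show ?case using step.IH s_eq[of v u] by (auto simp: fourth_roots_def)
  qed
  then have "phase_function D s"
    unfolding phase_function_def
  proof (intro conjI allI impI)
    fix u v
    show "s v = s u" if "edge_mult D u v \<noteq> 0"
      using s_eq[of v u] tight[of u v] that by simp
    show "s v = - \<i> * s u" if "arc_mult D u v \<noteq> 0"
      using s_eq[of v u] tight[of u v] that by simp
  qed
  moreover have "underlying D = G"
    unfolding underlying_D_eq_iff by (intro allI conjunct1[OF tight])
  ultimately show ?thesis by (intro conjI exI)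
qed

section \<open>From a phase function to a switching\<close>

text \<open>One switching suffices. Conjugation multiplies the entry at \<open>(u, v)\<close> by
  \<open>s u * cnj (s v)\<close>, which is 1 on an undirected edge, \<open>\<i>\<close> on an arc
  from \<open>u\<close> to \<open>v\<close> and \<open>- \<i>\<close> on an arc from
  \<open>v\<close> to \<open>u\<close>: exactly the contributions to the matrix of
  \<open>D\<close>.\<close>

lemma switching_equivalent_of_phase_function:
  assumes "underlying D = G" and s: "phase_function D s"
  shows "switching_equivalent G D"
proof -
  have mult: "edge_mult G u v = edge_mult D u v + arc_mult D u v + arc_mult D v u" for u v
    using iffD1[OF underlying_D_eq_iff assms(1), rule_format, of u v] by (rule sym)
  have unit: "s v * cnj (s v) = 1" for v
  proof -
    have "s v \<in> fourth_roots" using s unfolding phase_function_def by blast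
    then show ?thesis by (auto simp: fourth_roots_def)
  qed
  have s_edge: "s v = s u" if "edge_mult D u v \<noteq> 0" for u v
    using s that unfolding phase_function_def by blast
  have s_arc: "s v = - \<i> * s u" if "arc_mult D u v \<noteq> 0" for u v
    using s that unfolding phase_function_def by blast
  define T where "T = diag_mat s"
  define S where "S = diag_mat (\<lambda>v. cnj (s v))"
  have "T ** S = mat 1" unfolding T_def S_def by (rule diag_mat_inverse) (rule unit)
  then have inv: "matrix_inv S = T" by (rule matrix_inv_eqI)
  have "hermitian_adj D $ u $ v = s u * hermitian_adj G $ u $ v * cnj (s v)" for u v
  proof -
    have "of_real (edge_mult D u v) * (s u * cnj (s v)) = complex_of_real (edge_mult D u v)"
    proof (cases "edge_mult D u v = 0")
      case False
      then have "s v = s u" by (rule s_edge)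
      then show ?thesis by (simp add: unit)
    qed simp
    moreover have "of_real (arc_mult D u v) * (s u * cnj (s v)) = complex_of_real (arc_mult D u v) * \<i>"
    proof (cases "arc_mult D u v = 0")
      case False
      then have "s v = - \<i> * s u" by (rule s_arc)
      then have "s u * cnj (s v) = \<i> * (s u * cnj (s u))" by simp
      then show ?thesis by (simp add: unit)
    qed simp
    moreover have "of_real (arc_mult D v u) * (s u * cnj (s v)) = - complex_of_real (arc_mult D v u) * \<i>"
    proof (cases "arc_mult D v u = 0")
      case False
      then have "s u = - \<i> * s v" by (rule s_arc)
      then have "s u * cnj (s v) = - \<i> * (s v * cnj (s v))" by simp
      then show ?thesis by (simp add: unit)
    qed simp
    ultimately have "complex_of_real (edge_mult D u v + arc_mult D u v + arc_mult D v u) * (s u * cnj (s v)) = hermitian_adj D $ u $ v"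
      by (simp only: adj_D distrib_right of_real_add) simp
    then show ?thesis by (simp add: adj_G mult mult_ac)
  qed
  then have "hermitian_adj D = matrix_inv S ** hermitian_adj G ** S"
    unfolding inv unfolding T_def S_def by (simp add: vec_eq_iff diag_mat_mult)
  moreover have "cnj j \<in> fourth_roots" if "j \<in> fourth_roots" for j
    using that by (auto simp: fourth_roots_def)
  then have "S \<in> switching_matrices"
    using s by (simp add: switching_matrices_def S_def diag_mat_def phase_function_def)
  ultimately have "four_way_switching G D"
    using G mixed_D by (auto simp: four_way_switching_def undirected_multigraph_def)
  then show ?thesis by (auto simp: switching_equivalent_def switching_step_def)
qed

end

section \<open>Invariance of the spectrum under switching\<close>

text \<open>A four-way switching is a similarity by an invertible diagonal matrix. Reversing all
  arcs transposes the Hermitian adjacency matrix.\<close>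

lemma charpoly_switching_step:
  assumes "switching_step D D'"
  shows "charpoly (hermitian_adj D') = charpoly (hermitian_adj D)"
  using assms unfolding switching_step_def
proof
  assume "four_way_switching D D'"
  then obtain S where S: "S \<in> switching_matrices"
    and D': "hermitian_adj D' = matrix_inv S ** hermitian_adj D ** S"
    by (auto simp: four_way_switching_def)
  have S0: "S $ v $ v \<noteq> 0" "u \<noteq> v \<Longrightarrow> S $ u $ v = 0" for u v
    using S by (auto simp: switching_matrices_def fourth_roots_def dest!: spec[of _ v])
  define d where "d v = S $ v $ v" for v
  have "S = diag_mat d" by (simp add: diag_mat_def vec_eq_iff d_def S0)
  moreover have "diag_mat (\<lambda>v. inverse (d v)) ** diag_mat d = mat 1"
    by (rule diag_mat_inverse) (simp add: d_def S0)
  ultimately have "matrix_inv S = diag_mat (\<lambda>v. inverse (d v))" "diag_mat (\<lambda>v. inverse (d v)) ** S = mat 1"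
    by (simp_all add: matrix_inv_eqI)
  then have "matrix_inv S ** S = mat 1" by simp
  then show ?thesis by (simp add: D' charpoly_similar)
next
  assume D': "D' = converse_graph D"
  have "count (image_mset prod.swap M) (u, v) = count M (v, u)" for M :: "('a \<times> 'a) multiset" and u v
    by (induction M) auto
  moreover have "count (uedges D) (Upair u v) = count (uedges D) (Upair v u)" for u v
    by (rule arg_cong[of _ _ "count (uedges D)"]) simp
  ultimately have "hermitian_adj D' = transpose (hermitian_adj D)"
    unfolding D' by (simp add: hermitian_adj_def converse_graph_def transpose_def vec_eq_iff)
  then show ?thesis by (simp add: charpoly_transpose)
qed

text \<open>Equality of characteristic polynomials propagates along a sequence of steps and is
  symmetric, so reachability in either direction suffices.\<close>

lemma H_cospectral_of_switching_equivalent: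
  assumes "switching_equivalent D D'"
  shows "H_cospectral D D'"
proof -
  have "charpoly (hermitian_adj E') = charpoly (hermitian_adj E)"
    if "switching_step\<^sup>*\<^sup>* E E'" for E E' :: "'a mixed_mgraph"
    using that by induction (simp_all add: charpoly_switching_step)
  then show ?thesis
    using assms by (auto simp: switching_equivalent_def H_cospectral_def H_spectrum_def)
qed

section \<open>The cycle of implications (a), (b), (c), (d), (a)\<close>

theorem theorem4p1:
  fixes G D :: "'v::finite mixed_mgraph"
  assumes "undirected_multigraph G"
    and "connected_multigraph G"
    and "delete_orient G D"
  shows "(H_cospectral G D \<longleftrightarrow> eigval 1 G = eigval 1 D) \<and>
         (eigval 1 G = eigval 1 D \<longleftrightarrow>
            underlying D = G \<and> (\<exists>P. switching_partition D P)) \<and>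
         (underlying D = G \<and> (\<exists>P. switching_partition D P) \<longleftrightarrow>
            switching_equivalent G D)"
proof -
  have "eigval 1 G = eigval 1 D" if "H_cospectral G D"
    using that by (simp add: H_cospectral_def eigval_def)
  moreover have "underlying D = G \<and> (\<exists>P. switching_partition D P)" if "eigval 1 G = eigval 1 D"
    using phase_function_of_eigval_eq[OF assms that] by (simp add: switching_partition_iff)
  moreover have "switching_equivalent G D" if "underlying D = G \<and> (\<exists>P. switching_partition D P)"
    using that switching_equivalent_of_phase_function[OF assms] by (auto simp: switching_partition_iff)
  moreover have "H_cospectral G D" if "switching_equivalent G D"
    using that by (rule H_cospectral_of_switching_equivalent)
  ultimately show ?thesis by blast
qed

end
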